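(* Let $(a_n;n\geq 1)$ be a sequence of real numbers with $a_j\neq 0$ for all $j\geq 1$, and let $\varphi,g,h$ be power series with $\varphi(0)=0$ and $\varphi'(0)g(0)h(0)\neq 0$. Let $\mathcal{A}$ be the upper triangular matrix, indexed by $k,n\geq 1$, with entries \[ [\mathcal{A}]_{k,n}=\frac{a_k}{a_n}\frac{1}{k!}\left(\frac{d}{dt}\right)^{n-1}_{t=0}\left[(h(t))^n\frac{d}{dt}\left((\varphi(t))^k g(t)\right)\right]\quad (k\leq n), \] and $[\mathcal{A}]_{k,n}=0$ for $k>n$. Let $\omega$ be the power series with $\omega(0)=0$ satisfying $\omega(t)=t\,h(\omega(t))$. Then for every non-negative integer $s$, \[ [\mathcal{A}^{s}]_{k,n}=\frac{a_k}{a_n}\frac{1}{k!}\left(\frac{d}{dt}\right)^{n}_{t=0}\left[\left((\varphi\circ\omega)^{\langle s\rangle}(t)\right)^k\prod_{i=0}^{s-1} g\circ\omega\circ(\varphi\circ\omega)^{\langle i\rangle}(t)\right]. \]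
   Context: All power series are formal power series. $\left(\frac{d}{dt}\right)^{m}_{t=0}F$ denotes the $m$-th derivative of $F$ at $t=0$ ($m!$ times the coefficient of $t^m$). For a power series $\phi$ with $\phi(0)=0$: $\phi^{\langle 0\rangle}(t)=t$, $\phi^{\langle s\rangle}=\phi^{\langle s-1\rangle}\circ\phi$ for $s\geq1$. $\mathcal{A}^0=\mathcal{I}$ is the identity matrix; the empty product equals $1$. *)

theory Defs
  imports
    "HOL-Analysis.Infinite_Sum"
    "HOL-Computational_Algebra.Formal_Power_Series"
begin

definition deriv_at_0 :: "nat \<Rightarrow> real fps \<Rightarrow> real" where
  "deriv_at_0 m F = fps_nth (fps_nth_deriv m F) 0"

lemma deriv_at_0_eq: "deriv_at_0 m F = fact m * fps_nth F m"
  by (simp add: deriv_at_0_def fps_deriv_maclauren_0)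

fun fps_iter :: "nat \<Rightarrow> real fps \<Rightarrow> real fps" where
  "fps_iter 0 \<phi> = fps_X"
| "fps_iter (Suc s) \<phi> = fps_iter s \<phi> oo \<phi>"

text \<open>
  Infinite matrices are functions of a row and a column index. Indices are meant to be positive;
  entries with an index 0 carry no meaning and do not enter the product.
\<close>

type_synonym inf_matrix = "nat \<Rightarrow> nat \<Rightarrow> real"

definition mat_id :: inf_matrix where
  "mat_id k n = (if k = n then 1 else 0)"

definition mat_mult :: "inf_matrix \<Rightarrow> inf_matrix \<Rightarrow> inf_matrix" where
  "mat_mult A B k n = (\<Sum>\<^sub>\<infinity>j\<in>{1..}. A k j * B j n)"

fun mat_power :: "inf_matrix \<Rightarrow> nat \<Rightarrow> inf_matrix" where
  "mat_power A 0 = mat_id"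
| "mat_power A (Suc s) = mat_mult A (mat_power A s)"

text \<open>For upper triangular matrices the sum defining the product is finite.\<close>

lemma mat_mult_upper_triangular:
  assumes "\<And>k j. 1 \<le> j \<Longrightarrow> j < k \<Longrightarrow> A k j = 0"
    and "\<And>j n. 1 \<le> n \<Longrightarrow> n < j \<Longrightarrow> B j n = 0"
    and "1 \<le> k" "1 \<le> n"
  shows "mat_mult A B k n = (\<Sum>j=k..n. A k j * B j n)"
proof -
  have "(\<Sum>\<^sub>\<infinity>j\<in>{1..}. A k j * B j n) = (\<Sum>\<^sub>\<infinity>j\<in>{k..n}. A k j * B j n)"
    by (rule infsum_cong_neutral) (use assms in \<open>auto simp: not_le\<close>)
  then show ?thesis
    by (simp add: mat_mult_def)
qed

definition mat_A ::
  "(nat \<Rightarrow> real) \<Rightarrow> real fps \<Rightarrow> real fps \<Rightarrow> real fps \<Rightarrow> inf_matrix" where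
  "mat_A a \<phi> g h k n =
     (if k \<le> n then
        a k / a n * (1 / fact k) * deriv_at_0 (n - 1) (h ^ n * fps_deriv (\<phi> ^ k * g))
      else 0)"

text \<open>The equation for \<open>\<omega>\<close> has exactly one solution, so one may speak of \<^emph>\<open>the\<close> series \<open>\<omega>\<close>.\<close>

lemma omega_ex1:
  fixes h :: "real fps"
  assumes h0: "fps_nth h 0 \<noteq> 0"
  shows "\<exists>!\<omega>. fps_nth \<omega> 0 = 0 \<and> \<omega> = fps_X * (h oo \<omega>)"
proof -
  define f where "f = fps_X * inverse h"
  have f0: "fps_nth f 0 = 0" and f1: "fps_nth f 1 \<noteq> 0"
    using h0 by (simp_all add: f_def)
  have f_comp: "f oo w = w * inverse (h oo w)" if "fps_nth w 0 = 0" for w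
    using that h0 by (simp add: f_def fps_compose_mult_distrib fps_inverse_compose)
  have unit: "inverse (h oo w) * (h oo w) = 1" if "fps_nth w 0 = 0" for w
    using that h0 by (intro inverse_mult_eq_1) simp
  have eq_iff: "w = fps_X * (h oo w) \<longleftrightarrow> f oo w = fps_X" if w: "fps_nth w 0 = 0" for w
  proof
    assume "w = fps_X * (h oo w)"
    then have "w * inverse (h oo w) = fps_X * ((h oo w) * inverse (h oo w))"
      by (metis mult.assoc)
    also have "\<dots> = fps_X"
      using unit[OF w] by (metis mult.commute mult_1)
    finally show "f oo w = fps_X"
      by (simp only: f_comp[OF w])
  next
    assume "f oo w = fps_X"
    then have "fps_X * (h oo w) = w * (inverse (h oo w) * (h oo w))"
      by (simp add: f_comp[OF w] flip: mult.assoc)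
    then show "w = fps_X * (h oo w)"
      by (simp add: unit[OF w])
  qed
  show ?thesis
  proof (rule ex1I[of _ "fps_inv f"])
    have "fps_nth (fps_inv f) 0 = 0"
      by (simp add: fps_inv_def)
    then show "fps_nth (fps_inv f) 0 = 0 \<and> fps_inv f = fps_X * (h oo fps_inv f)"
      using eq_iff fps_inv_right[OF f0 f1] by blast
  next
    fix w assume w: "fps_nth w 0 = 0 \<and> w = fps_X * (h oo w)"
    then have "f oo w = fps_X" using eq_iff by blast
    then have "fps_inv f oo (f oo w) = fps_inv f" by simp
    moreover have "fps_inv f oo (f oo w) = (fps_inv f oo f) oo w"
      using w f0 by (simp add: fps_compose_assoc)
    ultimately show "w = fps_inv f"
      using w by (simp add: fps_inv[OF f0 f1])
  qed
qed

end

theory Submission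
  imports Defs
begin

text \<open>
  By Lagrange inversion \<open>n [t\<^sup>n] F(\<omega>(t)) = [t\<^sup>n\<^sup>-\<^sup>1] h(t)\<^sup>n F'(t)\<close>, the \<open>(k, n)\<close> entry of the matrix is
  \<open>(a\<^sub>k / a\<^sub>n) (n! / k!) [t\<^sup>n] (\<phi> \<circ> \<omega>)\<^sup>k (g \<circ> \<omega>)\<close>: up to conjugation by a diagonal matrix, it is the
  Riordan array of the pair \<open>(g \<circ> \<omega>, \<phi> \<circ> \<omega>)\<close>. Riordan arrays multiply by composition of series,
  so the powers are found by induction on the exponent.
\<close>

text \<open>The Riordan array of \<open>(c, b)\<close> acts on the coefficient sequence of
  \<open>a\<close>. As \<open>b\<close> has no constant term, \<open>b ^ m\<close> cannot reach
  degree \<open>n\<close> for \<open>m > n\<close>, so the sum is finite.\<close>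

lemma fps_mult_compose_nth:
  fixes b :: "'a::idom fps"
  assumes b0: "fps_nth b 0 = 0"
  shows "fps_nth (c * (a oo b)) n = (\<Sum>m=0..n. fps_nth a m * fps_nth (c * b ^ m) n)"
proof -
  have compose: "fps_nth (a oo b) i = (\<Sum>m=0..n. fps_nth a m * fps_nth (b ^ m) i)" if "i \<le> n" for i
    unfolding fps_compose_nth using that b0
    by (intro sum.mono_neutral_left) (auto simp: startsby_zero_power_prefix)
  have "fps_nth (c * (a oo b)) n =
      (\<Sum>i=0..n. \<Sum>m=0..n. fps_nth c i * (fps_nth a m * fps_nth (b ^ m) (n - i)))"
    by (simp add: fps_mult_nth compose sum_distrib_left)
  also have "\<dots> = (\<Sum>m=0..n. fps_nth a m * fps_nth (c * b ^ m) n)"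
    by (subst sum.swap) (simp add: fps_mult_nth sum_distrib_left mult.left_commute)
  finally show ?thesis .
qed

text \<open>Since \<open>h = fps_X / f\<close>, this coefficient is the residue of
  \<open>f ^ (m - N - 1) * fps_deriv f\<close> as a Laurent series. For \<open>m < N\<close> that is
  a derivative, with residue 0; for \<open>m = N\<close> it is the logarithmic derivative of a
  series of order 1. The proof stays within power series.\<close>

lemma fps_power_mult_deriv_nth:
  fixes f h :: "'a::field_char_0 fps"
  assumes f0: "fps_nth f 0 = 0" and fh: "f * h = fps_X" and "m \<le> N"
  shows "fps_nth (h ^ Suc N * fps_deriv f * f ^ m) N = (if m = N then 1 else 0)"
proof -
  define r where "r = N - m"
  have N: "Suc N = m + Suc r"
    using \<open>m \<le> N\<close> by (simp add: r_def)
  have deriv: "fps_deriv f * h = 1 - f * fps_deriv h"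
    using arg_cong[OF fh, of fps_deriv] by (simp add: algebra_simps)
  have "h ^ Suc N * fps_deriv f * f ^ m = (f * h) ^ m * (h ^ r * (fps_deriv f * h))"
    unfolding N by (simp add: power_add power_mult_distrib)
  also have "fps_nth \<dots> N = fps_nth (h ^ r * (1 - f * fps_deriv h)) r"
    using \<open>m \<le> N\<close> by (simp add: fh deriv fps_X_power_mult_nth r_def)
  also have "\<dots> = (if r = 0 then 1 else 0)"
  proof (cases r)
    case 0
    then show ?thesis by (simp add: f0)
  next
    case (Suc q)
    \<comment> \<open>The factor \<open>r\<close> turns the product into
      \<open>r * h ^ r - fps_X * fps_deriv (h ^ r)\<close>. The operator
      \<open>fps_X * fps_deriv\<close> multiplies the coefficient of degree \<open>r\<close> by
      \<open>r\<close>, so the two terms cancel there.\<close>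
    have "of_nat r * (h ^ r * (1 - f * fps_deriv h)) =
        of_nat r * h ^ r - f * h * (of_nat r * fps_deriv h * h ^ q)"
      by (simp add: Suc algebra_simps)
    also have "\<dots> = of_nat r * h ^ r - fps_X * fps_deriv (h ^ r)"
      by (simp add: Suc fh fps_deriv_power' del: power_Suc of_nat_Suc)
    finally have "fps_nth (of_nat r * (h ^ r * (1 - f * fps_deriv h))) r =
        fps_nth (of_nat r * h ^ r - fps_X * fps_deriv (h ^ r)) r"
      by (rule arg_cong)
    then show ?thesis
      by (simp add: Suc del: power_Suc of_nat_Suc)
  qed
  finally show ?thesis
    using \<open>m \<le> N\<close> by (auto simp: r_def)
qed

text \<open>The series \<open>\<omega>\<close> is the compositional inverse of
  \<open>f = fps_X / h\<close>. With \<open>H = F oo \<omega>\<close>, expanding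
  \<open>fps_deriv F\<close> in the series \<open>f ^ m * fps_deriv f\<close> leaves one term by the
  previous lemma, a coefficient of \<open>fps_deriv H\<close>.\<close>

theorem fps_lagrange_inversion:
  fixes F h \<omega> :: "'a::field_char_0 fps"
  assumes h0: "fps_nth h 0 \<noteq> 0" and \<omega>0: "fps_nth \<omega> 0 = 0" and \<omega>: "\<omega> = fps_X * (h oo \<omega>)"
    and "n \<ge> 1"
  shows "of_nat n * fps_nth (F oo \<omega>) n = fps_nth (h ^ n * fps_deriv F) (n - 1)"
proof -
  define f where "f = fps_X * inverse h"
  have f0: "fps_nth f 0 = 0" and f1: "fps_nth f 1 \<noteq> 0"
    using h0 by (simp_all add: f_def)
  have fh: "f * h = fps_X"
    using inverse_mult_eq_1[OF h0] by (simp add: f_def mult.assoc)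
  have "(f oo \<omega>) * (h oo \<omega>) = fps_X * (h oo \<omega>)"
    using arg_cong[OF fh, of "\<lambda>F. F oo \<omega>"] \<omega>0 \<omega> by (simp add: fps_compose_mult_distrib)
  moreover have "h oo \<omega> \<noteq> 0"
    using h0 by (metis fps_compose_nth_0 fps_zero_nth)
  ultimately have f\<omega>: "f oo \<omega> = fps_X"
    by simp
  \<comment> \<open>A right inverse of \<open>f\<close> agrees with its left inverse, which yields
    \<open>\<omega> oo f = fps_X\<close>.\<close>
  have "fps_inv f = fps_inv f oo (f oo \<omega>)"
    by (simp add: f\<omega>)
  also have "\<dots> = \<omega>"
    using \<omega>0 f0 by (simp add: fps_compose_assoc fps_inv[OF f0 f1])
  finally have \<omega>f: "\<omega> oo f = fps_X"
    using fps_inv[OF f0 f1] by simp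
  define H where "H = F oo \<omega>"
  have "F = H oo f"
    using f0 \<omega>0 by (simp add: H_def \<omega>f flip: fps_compose_assoc)
  then have deriv: "fps_deriv F = (fps_deriv H oo f) * fps_deriv f"
    by (simp add: fps_compose_deriv f0)
  obtain N where n: "n = Suc N"
    using \<open>n \<ge> 1\<close> by (cases n) auto
  have "fps_nth (h ^ n * fps_deriv F) N = fps_nth (h ^ Suc N * fps_deriv f * (fps_deriv H oo f)) N"
    by (simp add: deriv n mult_ac)
  also have "\<dots> = (\<Sum>m=0..N. fps_nth (fps_deriv H) m * (if m = N then 1 else 0))"
    unfolding fps_mult_compose_nth[OF f0]
    by (intro sum.cong) (simp_all add: fps_power_mult_deriv_nth[OF f0 fh] del: power_Suc)
  also have "\<dots> = of_nat n * fps_nth H n"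
    by (simp add: n mult_delta_right)
  finally show ?thesis
    by (simp add: H_def n)
qed

text \<open>No case distinction on \<open>k \<le> n\<close> remains: for \<open>k > n\<close> the
  right side vanishes by itself, because \<open>\<phi> oo \<omega>\<close> has no constant
  term.\<close>

lemma mat_A_eq:
  assumes "fps_nth \<phi> 0 = 0" "fps_nth h 0 \<noteq> 0" "fps_nth \<omega> 0 = 0" "\<omega> = fps_X * (h oo \<omega>)" "n \<ge> 1"
  shows "mat_A a \<phi> g h k n =
    a k / a n * (fact n / fact k) * fps_nth ((\<phi> oo \<omega>) ^ k * (g oo \<omega>)) n"
proof (cases "k \<le> n")
  case True
  have "fact n = fact (n - 1) * real n"
    using \<open>n \<ge> 1\<close> by (simp add: fact_reduce)
  moreover have "(\<phi> ^ k * g) oo \<omega> = (\<phi> oo \<omega>) ^ k * (g oo \<omega>)"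
    using assms(3) by (simp add: fps_compose_mult_distrib fps_compose_power)
  ultimately show ?thesis
    using True fps_lagrange_inversion[OF assms(2-5), of "\<phi> ^ k * g"]
    by (simp add: mat_A_def deriv_at_0_eq flip: mult.assoc)
next
  case False
  have "fps_nth (\<phi> oo \<omega>) 0 = 0"
    using assms(1) by simp
  then have "fps_nth ((\<phi> oo \<omega>) ^ k * (g oo \<omega>)) n = 0"
    using False by (simp add: fps_mult_nth startsby_zero_power_prefix)
  then show ?thesis
    using False by (simp add: mat_A_def)
qed

lemma fps_iter_nth_0:
  "fps_nth P 0 = 0 \<Longrightarrow> fps_nth (fps_iter s P) 0 = 0"
  by (induction s) simp_all

text \<open>\<open>fps_iter\<close> composes with \<open>P\<close> on the right, while the matrix
  product below produces \<open>P\<close> on the left.\<close>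

lemma fps_iter_commute:
  assumes "fps_nth P 0 = 0"
  shows "fps_iter s P oo P = P oo fps_iter s P"
  using assms by (induction s) (simp_all add: fps_iter_nth_0 flip: fps_compose_assoc)

theorem theorem2:
  fixes a :: "nat \<Rightarrow> real" and \<phi> g h \<omega> :: "real fps" and k n s :: nat
  assumes "\<And>j. j \<ge> 1 \<Longrightarrow> a j \<noteq> 0"
    and "fps_nth \<phi> 0 = 0"
    and "fps_nth (fps_deriv \<phi>) 0 * fps_nth g 0 * fps_nth h 0 \<noteq> 0"
    and "fps_nth \<omega> 0 = 0"
    and "\<omega> = fps_X * (h oo \<omega>)"
    and "k \<ge> 1" and "n \<ge> 1"
  shows "mat_power (mat_A a \<phi> g h) s k n =
    a k / a n * (1 / fact k) *
      deriv_at_0 n (fps_iter s (\<phi> oo \<omega>) ^ k *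
        (\<Prod>i<s. (g oo \<omega>) oo fps_iter i (\<phi> oo \<omega>)))"
proof -
  define P where "P = \<phi> oo \<omega>"
  define G where "G = g oo \<omega>"
  define Q where "Q s = (\<Prod>i<s. G oo fps_iter i P)" for s
  have P0: "fps_nth P 0 = 0"
    using assms(2) by (simp add: P_def)
  have h0: "fps_nth h 0 \<noteq> 0"
    using assms(3) by auto
  have A: "mat_A a \<phi> g h k n = a k / a n * (fact n / fact k) * fps_nth (P ^ k * G) n"
    if "n \<ge> 1" for k n
    unfolding P_def G_def using mat_A_eq[OF assms(2) h0 assms(4,5) that] .
  have "mat_power (mat_A a \<phi> g h) s k n =
      a k / a n * (fact n / fact k) * fps_nth (fps_iter s P ^ k * Q s) n"
    if "k \<ge> 1" "n \<ge> 1" for k n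
    using that
  proof (induction s arbitrary: k n)
    case 0
    then show ?case
      using assms(1)[of n] by (simp add: mat_id_def Q_def fps_X_power_nth)
  next
    case (Suc s)
    define R where "R = fps_iter s P"
    have R0: "fps_nth R 0 = 0"
      using P0 by (simp add: R_def fps_iter_nth_0)
    have low: "fps_nth (R ^ j * Q s) n = 0" if "n < j" for j n
      using that R0 by (simp add: fps_mult_nth startsby_zero_power_prefix)
    have "mat_power (mat_A a \<phi> g h) (Suc s) k n =
        (\<Sum>j=k..n. mat_A a \<phi> g h k j * mat_power (mat_A a \<phi> g h) s j n)"
      unfolding mat_power.simps
    proof (rule mat_mult_upper_triangular)
      show "mat_power (mat_A a \<phi> g h) s j n = 0" if "1 \<le> n" "n < j" for j n
        using that low by (simp add: Suc.IH flip: R_def)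
    qed (use Suc.prems in \<open>simp_all add: mat_A_def\<close>)
    \<comment> \<open>The diagonal conjugation telescopes: \<open>a j\<close> and
      \<open>fact j\<close> cancel between the two factors.\<close>
    also have "\<dots> = (\<Sum>j=k..n. a k / a n * (fact n / fact k) *
        (fps_nth (P ^ k * G) j * fps_nth (Q s * R ^ j) n))"
    proof (intro sum.cong refl)
      fix j assume "j \<in> {k..n}"
      then have "j \<ge> 1"
        using Suc.prems by simp
      then show "mat_A a \<phi> g h k j * mat_power (mat_A a \<phi> g h) s j n =
          a k / a n * (fact n / fact k) * (fps_nth (P ^ k * G) j * fps_nth (Q s * R ^ j) n)"
        using assms(1)[of j] Suc.prems
        by (simp add: A Suc.IH R_def mult.commute[of "Q s"]) (simp add: mult_ac)
    qed
    \<comment> \<open>\<open>P ^ k\<close> has order at least \<open>k\<close>, so the added terms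
      \<open>j < k\<close> are zero and the sum gets the range of
      \<open>fps_mult_compose_nth\<close>.\<close>
    also have "\<dots> = (\<Sum>j=0..n. a k / a n * (fact n / fact k) *
        (fps_nth (P ^ k * G) j * fps_nth (Q s * R ^ j) n))"
      using P0 by (intro sum.mono_neutral_left)
        (auto simp: fps_mult_nth[of "P ^ k"] startsby_zero_power_prefix)
    also have "\<dots> = a k / a n * (fact n / fact k) * fps_nth (Q s * ((P ^ k * G) oo R)) n"
      by (simp add: fps_mult_compose_nth[OF R0] sum_distrib_left)
    \<comment> \<open>\<open>P oo R\<close> is the next iterate, and \<open>G oo R\<close> is the
      new factor \<open>i = s\<close> of the product.\<close>
    also have "Q s * ((P ^ k * G) oo R) = fps_iter (Suc s) P ^ k * Q (Suc s)"
      using R0 P0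
      by (simp add: Q_def fps_compose_mult_distrib fps_iter_commute R_def mult_ac
          flip: fps_compose_power)
    finally show ?case .
  qed
  from this[OF assms(6,7)] show ?thesis
    by (simp add: deriv_at_0_eq P_def G_def Q_def)
qed

end
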